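(* Let $q$ be a prime power, let $X$ be a vector space over $\mathbb{F}_q$ of dimension $N\ge 2$, let $\mathcal{A}$ be an $m$-spread in $X$ and let $h$ be an integer with $1\leq h\leq m-1$. If $q\geq 64^{1/(h+1)}$, then for all positive integers $k$ with $$k\leq \frac{hN}{h+1}+\frac{m}{h+1}-m+h$$ there exist $(\mathcal{A},h)$-evasive $k$-dimensional subspaces in $X$.
   Context: An $m$-spread of $X$ is a collection $\mathcal{A}$ of $m$-dimensional $\mathbb{F}_q$-subspaces of $X$, pairwise intersecting trivially, such that every non-zero vector of $X$ lies in exactly one element of $\mathcal{A}$ (this forces $m$ to divide $N$). An $\mathbb{F}_q$-subspace $U\le X$ is $(\mathcal{A},h)$-evasive if $\dim_{\mathbb{F}_q}(U\cap S)\leq h$ for all $S\in\mathcal{A}$. *)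

theory Defs
  imports Complex_Main "HOL-Library.Cardinality"
begin

text \<open>
  The ambient vector space \<open>X\<close> is the whole type \<open>'b\<close>, with scalar multiplication \<open>scale\<close>; when the
  scalar type is a finite field, it is the field of \<open>q\<close> elements, where \<open>q\<close> is its cardinality.
\<close>

context vector_space
begin

definition is_spread :: "nat \<Rightarrow> 'b set set \<Rightarrow> bool" where
  "is_spread m \<A> \<longleftrightarrow>
     (\<forall>S\<in>\<A>. subspace S \<and> dim S = m) \<and>
     (\<forall>S\<in>\<A>. \<forall>T\<in>\<A>. S \<noteq> T \<longrightarrow> S \<inter> T = {0}) \<and>
     (\<forall>v. v \<noteq> 0 \<longrightarrow> (\<exists>!S. S \<in> \<A> \<and> v \<in> S))"

definition evasive :: "'b set set \<Rightarrow> nat \<Rightarrow> 'b set \<Rightarrow> bool" where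
  "evasive \<A> h U \<longleftrightarrow> subspace U \<and> (\<forall>S\<in>\<A>. dim (U \<inter> S) \<le> h)"

end

end

theory Submission
  imports Defs
begin

text \<open>Build a random \<open>k\<close>-dimensional subspace \<open>U\<close> one vector at a time. For fixed \<open>S \<in> \<A>\<close>, the
  probability that \<open>dim (U \<inter> S) > h\<close> is at most the Gaussian binomial coefficient
  \<open>[k, h + 1]\<close>, counting the \<open>(h + 1)\<close>-dimensional spaces of coefficient vectors, times
  \<open>q ^ ((h + 1) (m - N))\<close>. There are at most \<open>2 q ^ (N - m)\<close> spread elements and
  \<open>[k, h + 1] \<le> 4 q ^ ((h + 1) (k - h - 1))\<close>, so under the bound on \<open>k\<close> the union bound gives
  failure probability at most \<open>8 / q ^ (h + 1) < 1\<close>. The argument is derandomised by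
  conditional expectations: each new vector is chosen so that the sum over \<open>\<A>\<close> of these
  bounds does not increase.\<close>

section \<open>Counting linearly independent tuples\<close>

text \<open>The number of linearly independent \<open>r\<close>-tuples in an \<open>n\<close>-dimensional space over a field
  with \<open>x\<close> elements; it is 0 for \<open>r > n\<close> because of the factor \<open>i = n\<close>.\<close>

definition indep_count :: "real \<Rightarrow> nat \<Rightarrow> nat \<Rightarrow> real" where
  "indep_count x n r = (\<Prod>i<r. x ^ n - x ^ i)"

lemma indep_count_0 [simp]: "indep_count x n 0 = 1"
  by (simp add: indep_count_def)

lemma indep_count_Suc: "indep_count x n (Suc r) = indep_count x n r * (x ^ n - x ^ r)"
  by (simp add: indep_count_def)

text \<open>The factor \<open>i = 0\<close> splits off; each later factor is \<open>x\<close> times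
  the factor of index \<open>i - 1\<close> for \<open>n\<close>.\<close>

lemma indep_count_Suc_Suc:
  "indep_count x (Suc n) (Suc r) = (x ^ Suc n - 1) * x ^ r * indep_count x n r"
proof -
  have "(\<Prod>i<r. x ^ Suc n - x ^ Suc i) = (\<Prod>i<r. x * (x ^ n - x ^ i))"
    by (simp add: algebra_simps)
  then show ?thesis
    by (simp add: indep_count_def prod.lessThan_Suc_shift prod.distrib del: prod.lessThan_Suc)
qed

lemma indep_count_nonneg:
  assumes "x \<ge> 1"
  shows "indep_count x n r \<ge> 0"
proof (cases "r \<le> n")
  case True
  then show ?thesis
    unfolding indep_count_def using assms by (intro prod_nonneg) (auto intro!: power_increasing)
next
  case False
  then have "indep_count x n r = 0"
    unfolding indep_count_def by (intro prod_zero) auto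
  then show ?thesis by simp
qed

lemma indep_count_le:
  assumes "x \<ge> 1"
  shows "indep_count x n r \<le> x ^ (n * r)"
proof (induction r)
  case (Suc r)
  have "indep_count x n (Suc r) \<le> indep_count x n r * x ^ n"
    unfolding indep_count_Suc using assms indep_count_nonneg[OF assms, of n r]
    by (intro mult_left_mono) auto
  also have "\<dots> \<le> x ^ (n * r) * x ^ n"
    using Suc assms by (intro mult_right_mono) auto
  finally show ?case by (simp add: power_add mult.commute)
qed simp

text \<open>The bound without the summand \<open>2 / x ^ Suc r\<close> is too weak as an induction hypothesis.\<close>

lemma indep_count_self_ge_aux:
  assumes "x \<ge> 2"
  shows "4 * indep_count x (Suc r) (Suc r) \<ge> x ^ (Suc r * Suc r) * (1 + 2 / x ^ Suc r)"
proof (induction r)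
  case 0
  then show ?case using assms by (simp add: indep_count_def field_simps)
next
  case (Suc r)
  define n where "n = Suc r"
  define t where "t = x ^ n"
  have "x ^ 1 \<le> x ^ n"
    using assms by (intro power_increasing) (auto simp: n_def)
  then have t: "t \<ge> 2" "t \<ge> x" using assms by (auto simp: t_def)
  have xt: "x * t \<ge> 2 * t" using assms t by (intro mult_right_mono) auto
  \<comment> \<open>This is \<open>key\<close> cleared of the denominator \<open>t\<close>; by
    \<open>xt\<close> the difference is at least \<open>t - 2\<close>.\<close>
  have "(x * t - 1) * (t + 2) - (x * t + 2) * t = 2 * (x * t) - 3 * t - 2"
    by (simp add: algebra_simps)
  with xt t have "(x * t + 2) * t \<le> (x * t - 1) * (t + 2)" by linarith
  then have "x * t + 2 \<le> (x * t - 1) * (t + 2) / t" using t by (simp add: pos_le_divide_eq)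
  moreover have "x * t * (1 + 2 / (x * t)) = x * t + 2" using assms t by (simp add: distrib_left)
  moreover have "(t + 2) / t = 1 + 2 / t" using t by (simp add: add_divide_distrib)
  ultimately have key: "x * t * (1 + 2 / (x * t)) \<le> (x * t - 1) * (1 + 2 / t)"
    by (metis times_divide_eq_right)
  have "x ^ (Suc n * Suc n) * (1 + 2 / x ^ Suc n) = x ^ (n * n) * t * (x * t * (1 + 2 / (x * t)))"
    by (simp add: t_def power_add)
  also have "\<dots> \<le> x ^ (n * n) * t * ((x * t - 1) * (1 + 2 / t))"
    using assms t key by (intro mult_left_mono) auto
  also have "\<dots> = (x * t - 1) * t * (x ^ (n * n) * (1 + 2 / t))" by simp
  also have "\<dots> \<le> (x * t - 1) * t * (4 * indep_count x n n)"
  proof (rule mult_left_mono)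
    show "0 \<le> (x * t - 1) * t"
      using xt t by (intro mult_nonneg_nonneg) linarith+
  qed (use Suc in \<open>simp only: n_def t_def\<close>)
  also have "\<dots> = 4 * indep_count x (Suc n) (Suc n)"
    by (simp add: indep_count_Suc_Suc t_def)
  finally show ?case by (simp add: n_def)
qed

text \<open>In other words, the product of \<open>1 - 1 / x ^ i\<close> over
  \<open>1 \<le> i \<le> r\<close> is at least 1/4, uniformly in \<open>r\<close>. This is the
  source of the 4 in \<open>gauss_binomial_le\<close>.\<close>

lemma indep_count_self_ge:
  assumes "x \<ge> 2"
  shows "4 * indep_count x r r \<ge> x ^ (r * r)"
proof (cases r)
  case (Suc s)
  have "x ^ (r * r) * 1 \<le> x ^ (r * r) * (1 + 2 / x ^ r)"
    using assms by (intro mult_left_mono) auto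
  with indep_count_self_ge_aux[OF assms, of s] Suc show ?thesis by simp
qed simp

lemma indep_count_self_pos: "x \<ge> 2 \<Longrightarrow> indep_count x r r > 0"
  using indep_count_self_ge[of x r] zero_less_power[of x "r * r"] by linarith

section \<open>Gaussian binomial coefficients\<close>

text \<open>For a prime power \<open>x\<close> this counts the \<open>r\<close>-dimensional
  subspaces of an \<open>n\<close>-dimensional space: each of them has
  \<open>indep_count x r r\<close> ordered bases.\<close>

definition gauss_binomial :: "real \<Rightarrow> nat \<Rightarrow> nat \<Rightarrow> real" where
  "gauss_binomial x n r = indep_count x n r / indep_count x r r"

lemma gauss_binomial_0 [simp]: "gauss_binomial x n 0 = 1"
  by (simp add: gauss_binomial_def)

lemma gauss_binomial_nonneg: "x \<ge> 1 \<Longrightarrow> gauss_binomial x n r \<ge> 0"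
  by (simp add: gauss_binomial_def indep_count_nonneg)

lemma gauss_binomial_le:
  assumes "x \<ge> 2"
  shows "gauss_binomial x n r \<le> 4 * x ^ (n * r) / x ^ (r * r)"
proof -
  have "gauss_binomial x n r \<le> x ^ (n * r) / (x ^ (r * r) / 4)"
    unfolding gauss_binomial_def
    using assms indep_count_self_ge[OF assms, of r]
    by (intro frac_le indep_count_le) auto
  then show ?thesis by (simp add: mult.commute)
qed

text \<open>Up to the factor \<open>x ^ r\<close>, which avoids a negative exponent for
  \<open>n < r\<close>, the number \<open>x ^ Suc n - 1\<close> is a multiple of the next factor
  \<open>x ^ n - x ^ r\<close> plus the normalising factor \<open>D\<close>.\<close>

lemma gauss_binomial_pascal:
  assumes "x \<ge> 2"
  shows "gauss_binomial x (Suc n) (Suc r)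
    = x ^ Suc r * gauss_binomial x n (Suc r) + gauss_binomial x n r"
proof -
  define D where "D = (x ^ Suc r - 1) * x ^ r"
  have D: "D \<noteq> 0"
    using indep_count_self_pos[OF assms, of "Suc r"] assms
    by (auto simp: indep_count_Suc_Suc D_def)
  have B: "indep_count x r r \<noteq> 0"
    using indep_count_self_pos[OF assms, of r] by simp
  have "(x ^ Suc n - 1) * x ^ r = x ^ Suc r * (x ^ n - x ^ r) + D"
    by (simp add: D_def algebra_simps)
  then have "(x ^ Suc n - 1) * x ^ r * indep_count x n r
      = x ^ Suc r * (indep_count x n r * (x ^ n - x ^ r)) + D * indep_count x n r"
    using distrib_right[of "x ^ Suc r * (x ^ n - x ^ r)" D "indep_count x n r"]
    by (simp only: mult.assoc mult.commute[of "indep_count x n r" "x ^ n - x ^ r"])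
  moreover have "indep_count x (Suc r) (Suc r) = D * indep_count x r r"
    by (simp add: indep_count_Suc_Suc D_def)
  ultimately show ?thesis
    using D B
    by (simp add: gauss_binomial_def indep_count_Suc_Suc[of x n] indep_count_Suc[of x n]
        add_divide_distrib del: power_Suc)
qed

section \<open>The failure bound and its one-step recursion\<close>

text \<open>Adding \<open>n\<close> random vectors one after another to a subspace \<open>U\<close> raises the dimension of
  \<open>U \<inter> S\<close> by \<open>r = h + 1 - d\<close> or more with probability at most \<open>z ^ r\<close> times a
  Gaussian binomial coefficient,
  where \<open>z\<close> bounds the probability that the first vector raises it. Here \<open>y\<close> is \<open>|S| / |X|\<close>, and
  \<open>j\<close> and \<open>d\<close> are the dimensions of \<open>U\<close> and \<open>U \<inter> S\<close>; the truncated subtraction gives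
  weight 1 once \<open>d > h\<close>.\<close>

definition weight :: "real \<Rightarrow> real \<Rightarrow> nat \<Rightarrow> nat \<Rightarrow> nat \<Rightarrow> nat \<Rightarrow> real" where
  "weight x y h n j d = (y * x ^ j / x ^ d) ^ (Suc h - d) * gauss_binomial x n (Suc h - d)"

lemma weight_nonneg: "x \<ge> 1 \<Longrightarrow> y \<ge> 0 \<Longrightarrow> weight x y h n j d \<ge> 0"
  by (simp add: weight_def gauss_binomial_nonneg)

lemma weight_eq_1: "h < d \<Longrightarrow> weight x y h n j d = 1"
  by (simp add: weight_def)

text \<open>This is the q-Pascal rule: raising \<open>j\<close> alone multiplies the base
  \<open>z\<close> by \<open>x\<close>, while raising \<open>j\<close> and \<open>d\<close> together
  keeps \<open>z\<close> and lowers the exponent by one. Here \<open>z\<close> acts as the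
  probability of growth, and that of no growth is replaced by 1.\<close>

lemma weight_step:
  assumes "x \<ge> 2" "d \<le> h"
  shows "weight x y h n (Suc j) d + y * x ^ j / x ^ d * weight x y h n (Suc j) (Suc d)
    = weight x y h (Suc n) j d"
proof -
  obtain s where s: "h = d + s" using assms(2) le_Suc_ex by blast
  define z where "z = y * x ^ j / x ^ d"
  have z: "y * x ^ Suc j / x ^ Suc d = z" "y * x ^ Suc j / x ^ d = x * z"
    using assms by (auto simp: z_def)
  have "weight x y h n (Suc j) d = (x * z) ^ Suc s * gauss_binomial x n (Suc s)"
    and "weight x y h n (Suc j) (Suc d) = z ^ s * gauss_binomial x n s"
    and "weight x y h (Suc n) j d = z ^ Suc s * gauss_binomial x (Suc n) (Suc s)"
    unfolding weight_def z by (simp_all add: s z_def Suc_diff_le del: power_Suc)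
  then show ?thesis
    unfolding z_def[symmetric]
    by (simp add: gauss_binomial_pascal[OF assms(1)] power_mult_distrib algebra_simps)
qed

section \<open>Subspaces over a finite field\<close>

locale finite_vector_space = finite_dimensional_vector_space scale Basis
  for scale :: "'a::{field,finite} \<Rightarrow> 'b::ab_group_add \<Rightarrow> 'b" (infixr \<open>*s\<close> 75)
    and Basis :: "'b set"
begin

lemma card_span_independent:
  assumes "finite B" "independent B"
  shows "finite (span B) \<and> card (span B) = CARD('a) ^ card B"
  using assms
proof (induction B rule: finite_induct)
  case (insert a B)
  have ind: "independent B" and a: "a \<notin> span B"
    using insert.prems insert.hyps by (auto simp: independent_insert)
  let ?f = "\<lambda>(c, v). v + c *s a"
  have "span (insert a B) = ?f ` (UNIV \<times> span B)"
  proof (intro set_eqI iffI)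
    fix x assume "x \<in> span (insert a B)"
    then obtain c where "x - c *s a \<in> span B" by (auto simp: span_insert)
    then show "x \<in> ?f ` (UNIV \<times> span B)" by (intro image_eqI[of _ _ "(c, x - c *s a)"]) auto
  next
    fix x assume "x \<in> ?f ` (UNIV \<times> span B)"
    then obtain c v where "x = v + c *s a" "v \<in> span B" by auto
    then have "x - c *s a \<in> span B" by simp
    then show "x \<in> span (insert a B)" by (auto simp: span_insert)
  qed
  moreover have "inj_on ?f (UNIV \<times> span B)"
  proof (intro inj_onI, clarify)
    fix c v c' v'
    assume v: "v \<in> span B" "v' \<in> span B" and eq: "v + c *s a = v' + c' *s a"
    have "(c - c') *s a = v' - v"
      using eq by (simp add: scale_left_diff_distrib algebra_simps)
    then have mem: "(c - c') *s a \<in> span B" using v by (simp add: span_diff)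
    have "c = c'"
    proof (rule ccontr)
      assume "c \<noteq> c'"
      then have "a = inverse (c - c') *s ((c - c') *s a)" by simp
      with mem a show False by (metis span_scale)
    qed
    with eq show "c = c' \<and> v = v'" by simp
  qed
  ultimately show ?case
    using insert.IH[OF ind] insert.hyps by (simp add: card_image card_cartesian_product)
qed simp

lemma card_subspace:
  assumes "subspace U"
  shows "finite U" "card U = CARD('a) ^ dim U"
proof -
  obtain B where "B \<subseteq> U" "independent B" "U \<subseteq> span B" "card B = dim U"
    using basis_exists .
  moreover from this have "span B = U"
    using assms by (simp add: span_minimal subset_antisym)
  ultimately show "finite U" "card U = CARD('a) ^ dim U"
    using card_span_independent[of B] finiteI_independent by auto
qed

lemma finite_vectors: "finite (UNIV :: 'b set)"
  using card_subspace(1)[OF subspace_UNIV] .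

text \<open>A vector of \<open>S\<close> that involves \<open>v\<close> with non-zero coefficient
  would put \<open>v\<close> into \<open>U + S\<close>; so even the intersection itself stays the
  same.\<close>

lemma dim_insert_Int_unchanged:
  assumes U: "subspace U" and S: "subspace S" and v: "v \<notin> {u + s |u s. u \<in> U \<and> s \<in> S}"
  shows "dim (span (insert v U) \<inter> S) = dim (U \<inter> S)"
proof -
  have spU: "span U = U" using U by (simp add: span_eq_iff)
  have "x \<in> U" if x: "x \<in> span (insert v U)" "x \<in> S" for x
  proof -
    obtain c where c: "x - c *s v \<in> U" using x spU by (auto simp: span_insert)
    have "c = 0"
    proof (rule ccontr)
      assume "c \<noteq> 0"
      then have "v = inverse c *s (- (x - c *s v)) + inverse c *s x"
        by (simp add: scale_right_diff_distrib)
      moreover have "inverse c *s (- (x - c *s v)) \<in> U"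
        using c U subspace_scale subspace_neg by metis
      moreover have "inverse c *s x \<in> S"
        using x(2) S subspace_scale by metis
      ultimately show False using v by blast
    qed
    with c show ?thesis by simp
  qed
  moreover have "U \<subseteq> span (insert v U)" using span_superset[of "insert v U"] by simp
  ultimately have "span (insert v U) \<inter> S = U \<inter> S" by blast
  then show ?thesis by simp
qed

text \<open>Modulo \<open>U\<close>, the vector \<open>v = u + s\<close> equals \<open>s\<close>, so
  the new intersection is spanned by \<open>U \<inter> S\<close> and \<open>s\<close>.\<close>

lemma dim_insert_Int_Suc:
  assumes U: "subspace U" and S: "subspace S" and v: "v \<in> {u + s |u s. u \<in> U \<and> s \<in> S}" "v \<notin> U"
  shows "dim (span (insert v U) \<inter> S) = Suc (dim (U \<inter> S))"
proof -
  have spU: "span U = U" using U by (simp add: span_eq_iff)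
  have spI: "span (U \<inter> S) = U \<inter> S"
    using subspace_inter[OF U S] by (simp only: span_eq_iff)
  obtain u s where us: "v = u + s" "u \<in> U" "s \<in> S" using v by auto
  have s: "s \<notin> U" using v(2) us subspace_add[OF U] by metis
  have "span (insert v U) \<inter> S = span (insert s (U \<inter> S))"
  proof (intro set_eqI iffI)
    fix x assume x: "x \<in> span (insert v U) \<inter> S"
    then obtain c where c: "x - c *s v \<in> U" unfolding span_insert spU by blast
    have "x - c *s s = (x - c *s v) + c *s u" using us by (simp add: scale_right_distrib)
    then have "x - c *s s \<in> U"
      using subspace_add[OF U c subspace_scale[OF U us(2)], of c] by (simp only:)
    moreover have "x - c *s s \<in> S"
      using x us S subspace_diff subspace_scale by blast
    ultimately show "x \<in> span (insert s (U \<inter> S))" unfolding span_insert spI by blast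
  next
    fix x assume "x \<in> span (insert s (U \<inter> S))"
    then obtain c where c: "x - c *s s \<in> U" "x - c *s s \<in> S" unfolding span_insert spI by blast
    have "x - c *s v = (x - c *s s) - c *s u" using us by (simp add: scale_right_distrib)
    then have "x - c *s v \<in> U"
      using subspace_diff[OF U c(1) subspace_scale[OF U us(2)], of c] by (simp only:)
    moreover have "x \<in> S"
      using subspace_add[OF S c(2) subspace_scale[OF S us(3)], of c] by simp
    ultimately show "x \<in> span (insert v U) \<inter> S" unfolding span_insert spU by blast
  qed
  moreover have "s \<notin> span (U \<inter> S)" unfolding spI using s by simp
  ultimately show ?thesis by (simp add: dim_insert)
qed

section \<open>Choosing the next vector by averaging\<close>

text \<open>The number of \<open>v \<notin> U\<close> for which \<open>dim (U \<inter> S)\<close> grows is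
  \<open>|U + S| - |U|\<close>, which is at most \<open>|X - U|\<close> times \<open>|U + S| / |X|\<close>.\<close>

lemma sum_weight_extensions_le:
  fixes g :: "nat \<Rightarrow> real"
  assumes U: "subspace U" and S: "subspace S"
  shows "(\<Sum>v\<in>- U. g (dim (span (insert v U) \<inter> S)))
    \<le> card (- U) * (g (dim (U \<inter> S))
        + real CARD('a) ^ dim S / real CARD('a) ^ dim (UNIV :: 'b set) * real CARD('a) ^ dim U
          / real CARD('a) ^ dim (U \<inter> S)
          * max 0 (g (Suc (dim (U \<inter> S))) - g (dim (U \<inter> S))))"
proof -
  define x where "x = real CARD('a)"
  define N where "N = dim (UNIV :: 'b set)"
  define d where "d = dim (U \<inter> S)"
  define T where "T = {u + s |u s. u \<in> U \<and> s \<in> S}"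
  define f where "f v = g (dim (span (insert v U) \<inter> S))" for v
  have x: "x > 0" by (simp add: x_def)
  have T: "subspace T" unfolding T_def using subspace_sums[OF U S] .
  have UT: "U \<subseteq> T"
  proof
    fix u assume "u \<in> U"
    then have "u + 0 \<in> T" unfolding T_def using subspace_0[OF S] by blast
    then show "u \<in> T" by simp
  qed
  have fin: "finite A" for A :: "'b set" by (rule finite_subset[OF subset_UNIV finite_vectors])
  have cd: "card A = x ^ dim A" if "subspace A" for A
    using card_subspace(2)[OF that] by (simp add: x_def)
  have diff: "real (card (B - A)) = card B - real (card A)" if "A \<subseteq> B" for A B :: "'b set"
    using that fin[of A] card_mono[OF fin that] by (simp add: card_Diff_subset of_nat_diff)
  have "dim T + d = dim U + dim S" unfolding T_def d_def using dim_sums_Int[OF U S] .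
  then have "x ^ dim T * x ^ d = x ^ dim U * x ^ dim S" by (metis power_add)
  then have a: "x ^ dim T = x ^ dim S * x ^ dim U / x ^ d"
    using x by (simp add: field_simps)
  have cU: "card (- U) = x ^ N - x ^ dim U"
    using diff[of U UNIV] cd[OF U] cd[OF subspace_UNIV] by (simp add: Compl_eq_Diff_UNIV N_def)
  have cT: "card (T - U) = x ^ dim T - x ^ dim U"
    using diff[OF UT] cd[OF U] cd[OF T] by simp
  have cT': "card (- T) = card (- U) - real (card (T - U))"
    using diff[of T UNIV] diff[of U UNIV] diff[OF UT] by (simp add: Compl_eq_Diff_UNIV)
  have le: "x ^ dim T \<le> x ^ N"
    unfolding x_def N_def by (intro power_increasing dim_subset) auto
  \<comment> \<open>Removing \<open>U\<close> from both \<open>T\<close> and the whole space cannot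
    increase the proportion of \<open>T\<close>. The product form also covers
    \<open>U = UNIV\<close>.\<close>
  have "(x ^ dim T - x ^ dim U) * x ^ N \<le> (x ^ N - x ^ dim U) * x ^ dim T"
    using mult_left_mono[OF le, of "x ^ dim U"] x by (simp add: algebra_simps)
  then have prob: "card (T - U) \<le> card (- U) * (x ^ dim T / x ^ N)"
    unfolding cU cT using x by (simp add: pos_le_divide_eq)
  have grow: "f v = g (Suc d)" if "v \<in> T" "v \<notin> U" for v
    using dim_insert_Int_Suc[OF U S that(1)[unfolded T_def] that(2)] by (simp only: f_def d_def)
  have stay: "f v = g d" if "v \<notin> T" for v
    using dim_insert_Int_unchanged[OF U S that[unfolded T_def]] by (simp only: f_def d_def)
  have "- U = (T - U) \<union> - T" using UT by blast
  then have "sum f (- U) = sum f (T - U) + sum f (- T)"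
    using sum.union_disjoint[of "T - U" "- T" f] fin by auto
  also have "sum f (T - U) = (\<Sum>v\<in>T - U. g (Suc d))"
    by (intro sum.cong) (auto simp: grow)
  also have "sum f (- T) = (\<Sum>v\<in>- T. g d)"
    by (intro sum.cong) (auto simp: stay)
  also have "(\<Sum>v\<in>T - U. g (Suc d)) + (\<Sum>v\<in>- T. g d)
      = card (- U) * g d + card (T - U) * (g (Suc d) - g d)"
    by (simp add: cT' algebra_simps)
  also have "\<dots> \<le> card (- U) * g d
      + card (- U) * (x ^ dim T / x ^ N) * max 0 (g (Suc d) - g d)"
  proof -
    \<comment> \<open>\<open>prob\<close> is only an upper bound, so its cofactor must be
      non-negative; hence the positive part.\<close>
    have "card (T - U) * (g (Suc d) - g d) \<le> card (T - U) * max 0 (g (Suc d) - g d)"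
      by (intro mult_left_mono) auto
    also have "\<dots> \<le> card (- U) * (x ^ dim T / x ^ N) * max 0 (g (Suc d) - g d)"
      using prob by (intro mult_right_mono) auto
    finally show ?thesis by simp
  qed
  also have "\<dots> = card (- U) * (g d + x ^ dim S / x ^ N * x ^ dim U / x ^ d
      * max 0 (g (Suc d) - g d))"
    by (simp add: a distrib_left mult_ac)
  finally show ?thesis
    unfolding f_def d_def x_def N_def .
qed

text \<open>If every \<open>v\<close> outside \<open>U\<close> exceeded the bound, summing over the
  non-empty set \<open>- U\<close> and swapping the sums would contradict the average for each
  \<open>S\<close>.\<close>

lemma exists_extension_sum_weight_le:
  fixes g :: "nat \<Rightarrow> real"
  assumes U: "subspace U" "U \<noteq> UNIV" and \<A>: "\<forall>S\<in>\<A>. subspace S \<and> dim S = m"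
  shows "\<exists>v. v \<notin> U \<and> (\<Sum>S\<in>\<A>. g (dim (span (insert v U) \<inter> S)))
    \<le> (\<Sum>S\<in>\<A>. g (dim (U \<inter> S))
        + real CARD('a) ^ m / real CARD('a) ^ dim (UNIV :: 'b set) * real CARD('a) ^ dim U
          / real CARD('a) ^ dim (U \<inter> S)
          * max 0 (g (Suc (dim (U \<inter> S))) - g (dim (U \<inter> S))))"
    (is "\<exists>v. v \<notin> U \<and> ?\<Phi> v \<le> sum ?B \<A>")
proof (rule ccontr)
  assume "\<not> ?thesis"
  then have *: "sum ?B \<A> < ?\<Phi> v" if "v \<in> - U" for v using that by force
  have fin: "finite (- U)" by (rule finite_subset[OF subset_UNIV finite_vectors])
  have "card (- U) * sum ?B \<A> = (\<Sum>v\<in>- U. sum ?B \<A>)" by simp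
  also have "\<dots> < (\<Sum>v\<in>- U. ?\<Phi> v)"
    by (rule sum_strict_mono[OF fin _ *]) (use U in auto)
  also have "\<dots> = (\<Sum>S\<in>\<A>. \<Sum>v\<in>- U. g (dim (span (insert v U) \<inter> S)))"
    by (rule sum.swap)
  also have "\<dots> \<le> (\<Sum>S\<in>\<A>. card (- U) * ?B S)"
  proof (rule sum_mono)
    fix S assume "S \<in> \<A>"
    then show "(\<Sum>v\<in>- U. g (dim (span (insert v U) \<inter> S))) \<le> card (- U) * ?B S"
      using sum_weight_extensions_le[where g = g, OF U(1), of S] \<A> by auto
  qed
  also have "\<dots> = card (- U) * sum ?B \<A>" by (simp add: sum_distrib_left)
  finally show False by simp
qed

text \<open>At \<open>j = 0\<close> all intersections are trivial and equality holds. At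
  \<open>j = k\<close> no vectors remain and the weights are 0 or 1, so the sum counts the
  \<open>S\<close> with \<open>dim (U \<inter> S) > h\<close>.\<close>

lemma exists_subspace_sum_weight_le:
  fixes m h k :: nat and x y :: real
  defines "x \<equiv> real CARD('a)"
  defines "y \<equiv> x ^ m / x ^ dim (UNIV :: 'b set)"
  assumes \<A>: "\<forall>S\<in>\<A>. subspace S \<and> dim S = m" and k: "k \<le> dim (UNIV :: 'b set)"
    and j: "j \<le> k"
  shows "\<exists>U. subspace U \<and> dim U = j
    \<and> (\<Sum>S\<in>\<A>. weight x y h (k - j) j (dim (U \<inter> S))) \<le> card \<A> * weight x y h k 0 0"
  using j
proof (induction j)
  case 0
  have "dim ({0} \<inter> S) = 0" for S :: "'b set"
    using dim_subset[of "{0} \<inter> S" "{0}"] by simp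
  then show ?case
    by (intro exI[of _ "{0}"]) (auto simp: subspace_single_0 simp del: dim_eq_0)
next
  case (Suc j)
  have x2: "x \<ge> 2"
    using card_mono[of UNIV "{0, 1 :: 'a}"] by (simp add: x_def)
  have y: "y \<ge> 0" using x2 by (simp add: y_def)
  obtain U where U: "subspace U" "dim U = j"
    "(\<Sum>S\<in>\<A>. weight x y h (k - j) j (dim (U \<inter> S))) \<le> card \<A> * weight x y h k 0 0"
    using Suc by auto
  have "U \<noteq> UNIV" using U Suc.prems k by auto
  have spU: "span U = U" using U by (simp add: span_eq_iff)
  let ?g = "\<lambda>d. weight x y h (k - Suc j) (Suc j) d"
  obtain v where v: "v \<notin> U"
    "(\<Sum>S\<in>\<A>. ?g (dim (span (insert v U) \<inter> S)))
      \<le> (\<Sum>S\<in>\<A>. ?g (dim (U \<inter> S))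
          + y * x ^ j / x ^ dim (U \<inter> S) * max 0 (?g (Suc (dim (U \<inter> S))) - ?g (dim (U \<inter> S))))"
    using exists_extension_sum_weight_le[OF U(1) \<open>U \<noteq> UNIV\<close> \<A>, of ?g]
    unfolding x_def[symmetric] y_def[symmetric] U(2) by auto
  note v(2)
  also have "(\<Sum>S\<in>\<A>. ?g (dim (U \<inter> S))
          + y * x ^ j / x ^ dim (U \<inter> S) * max 0 (?g (Suc (dim (U \<inter> S))) - ?g (dim (U \<inter> S))))
      \<le> (\<Sum>S\<in>\<A>. weight x y h (k - j) j (dim (U \<inter> S)))"
  proof (rule sum_mono)
    fix S
    let ?d = "dim (U \<inter> S)"
    show "?g ?d + y * x ^ j / x ^ ?d * max 0 (?g (Suc ?d) - ?g ?d) \<le> weight x y h (k - j) j ?d"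
    \<comment> \<open>Up to \<open>h\<close>, the positive part is at most
      \<open>?g (Suc ?d)\<close>, which leaves the left side of \<open>weight_step\<close>. Beyond
      \<open>h\<close> all weights are 1 and the positive part vanishes.\<close>
    proof (cases "?d \<le> h")
      case True
      have "?g ?d + y * x ^ j / x ^ ?d * max 0 (?g (Suc ?d) - ?g ?d)
          \<le> ?g ?d + y * x ^ j / x ^ ?d * ?g (Suc ?d)"
        using weight_nonneg[of x y h "k - Suc j" "Suc j"] x2 y
        by (intro add_left_mono mult_left_mono) auto
      also have "\<dots> = weight x y h (Suc (k - Suc j)) j ?d"
        using weight_step[OF x2 True] .
      finally show ?thesis using Suc.prems by (simp add: Suc_diff_Suc)
    qed (simp add: weight_eq_1)
  qed
  also note U(3)
  finally have "(\<Sum>S\<in>\<A>. ?g (dim (span (insert v U) \<inter> S))) \<le> card \<A> * weight x y h k 0 0" .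
  moreover have "v \<notin> span U" unfolding spU by (rule v(1))
  ultimately show ?case
    using U(2)
    by (intro exI[of _ "span (insert v U)"]) (simp add: dim_insert)
qed

section \<open>Size of a spread and the union bound\<close>

text \<open>The sets \<open>S - {0}\<close> partition the non-zero vectors.\<close>

lemma card_spread:
  assumes "is_spread m \<A>"
  shows "finite \<A>" "card \<A> * (real CARD('a) ^ m - 1) = real CARD('a) ^ dim (UNIV :: 'b set) - 1"
proof -
  have fin: "finite A" for A :: "'b set" by (rule finite_subset[OF subset_UNIV finite_vectors])
  have "\<A> \<subseteq> Pow UNIV" by simp
  moreover have "finite (Pow (UNIV :: 'b set))"
    by (rule finite_Pow_iff[THEN iffD2, OF finite_vectors])
  ultimately show "finite \<A>" by (rule finite_subset)
  have sub: "subspace S" "dim S = m" if "S \<in> \<A>" for S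
    using assms that by (auto simp: is_spread_def)
  have c: "real (card (S - {0})) = real CARD('a) ^ dim S - 1" if "subspace S" for S
  proof -
    have "card (S - {0}) = CARD('a) ^ dim S - 1"
      using card_subspace[OF that] subspace_0[OF that] by simp
    then show ?thesis by (simp add: of_nat_diff)
  qed
  have disj: "(S - {0}) \<inter> (T - {0}) = {}" if "S \<in> \<A>" "T \<in> \<A>" "S \<noteq> T" for S T
  proof -
    have "S \<inter> T = {0}" using assms that by (simp add: is_spread_def)
    then show ?thesis by blast
  qed
  have "UNIV - {0} = (\<Union>S\<in>\<A>. S - {0})"
    using assms by (auto simp: is_spread_def)
  moreover have "card (\<Union>S\<in>\<A>. S - {0}) = (\<Sum>S\<in>\<A>. card (S - {0}))"
    using disj fin \<open>finite \<A>\<close> by (intro card_UN_disjoint) simp_all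
  ultimately have "real (card (UNIV - {0 :: 'b})) = (\<Sum>S\<in>\<A>. real (card (S - {0})))"
    by simp
  also have "\<dots> = (\<Sum>S\<in>\<A>. real CARD('a) ^ m - 1)"
    using c sub by (intro sum.cong) auto
  finally show "card \<A> * (real CARD('a) ^ m - 1) = real CARD('a) ^ dim (UNIV :: 'b set) - 1"
    using c[OF subspace_UNIV] by simp
qed

lemma exists_evasive:
  fixes m h k :: nat
  assumes \<A>: "is_spread m \<A>" and m: "1 \<le> m" "m \<le> dim (UNIV :: 'b set)"
    and k: "k \<le> dim (UNIV :: 'b set)" "Suc h * k \<le> h * (dim (UNIV :: 'b set) - m) + h * Suc h"
    and q: "real CARD('a) ^ Suc h > 8"
  shows "\<exists>U. evasive \<A> h U \<and> dim U = k"
proof -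
  define x where "x = real CARD('a)"
  define N where "N = dim (UNIV :: 'b set)"
  define y where "y = x ^ m / x ^ N"
  have x2: "x \<ge> 2"
    using card_mono[of UNIV "{0, 1 :: 'a}"] by (simp add: x_def)
  have y: "y > 0" using x2 by (simp add: y_def)
  have N: "N = m + (N - m)" using m by (simp add: N_def)
  have y': "y = 1 / x ^ (N - m)"
    unfolding y_def by (subst N, subst power_add) (use x2 in simp)
  \<comment> \<open>Since \<open>x ^ m \<ge> 2\<close>, half of \<open>x ^ m\<close> is at most
    \<open>x ^ m - 1\<close>; this costs the factor 2 in \<open>cA\<close>.\<close>
  have "x ^ 1 \<le> x ^ m" using m x2 by (intro power_increasing) auto
  then have "card \<A> * (x ^ m / 2) \<le> card \<A> * (x ^ m - 1)"
    using x2 by (intro mult_left_mono) auto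
  also have "\<dots> \<le> x ^ N"
    using card_spread(2)[OF \<A>] by (simp add: x_def N_def)
  finally have cA: "card \<A> \<le> 2 / y" using x2 by (simp add: y_def field_simps)
  have "card \<A> * weight x y h k 0 0 \<le> 2 / y * (y ^ Suc h * (4 * x ^ (k * Suc h) / x ^ (Suc h * Suc h)))"
    unfolding weight_def
    using cA y x2 gauss_binomial_nonneg[of x k "Suc h"] gauss_binomial_le[OF x2, of k "Suc h"]
    by (intro mult_mono) (auto simp del: power_Suc mult_Suc mult_Suc_right)
  also have "\<dots> = 8 * y ^ h * x ^ (k * Suc h) / x ^ (Suc h * Suc h)"
    using y by (simp del: mult_Suc mult_Suc_right)
  also have "\<dots> \<le> 8 * y ^ h * x ^ (h * (N - m) + h * Suc h) / x ^ (Suc h * Suc h)"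
    using k(2) x2 y unfolding N_def[symmetric]
    by (intro divide_right_mono mult_left_mono power_increasing)
       (auto simp: mult.commute simp del: mult_Suc mult_Suc_right)
  \<comment> \<open>\<open>y ^ h\<close> cancels \<open>x ^ (h * (N - m))\<close>, and the remaining
    exponent is \<open>h * Suc h - Suc h * Suc h\<close>.\<close>
  also have "\<dots> = 8 / x ^ Suc h"
  proof -
    have "x ^ (Suc h * Suc h) = x ^ Suc h * x ^ (h * Suc h)"
      by (simp add: power_add)
    moreover have "y ^ h * x ^ (h * (N - m)) = 1"
      using x2 by (simp add: y' power_one_over power_mult mult.commute[of h])
    ultimately show ?thesis
      using x2 by (simp add: power_add[of x "h * (N - m)"] del: power_Suc mult_Suc mult_Suc_right)
  qed
  also have "\<dots> < 1" using q x2 by (simp add: x_def del: power_Suc)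
  finally have start: "card \<A> * weight x y h k 0 0 < 1" .
  have "\<forall>S\<in>\<A>. subspace S \<and> dim S = m" using \<A> by (simp add: is_spread_def)
  from exists_subspace_sum_weight_le[OF this k(1) order_refl, of h]
  obtain U where U: "subspace U" "dim U = k"
    and sum: "(\<Sum>S\<in>\<A>. weight x y h 0 k (dim (U \<inter> S))) < 1"
    using start unfolding x_def y_def N_def by force
  \<comment> \<open>A single bad \<open>S\<close> would contribute 1 to a sum of non-negative terms
    below 1.\<close>
  have "dim (U \<inter> S) \<le> h" if "S \<in> \<A>" for S
  proof (rule ccontr)
    assume "\<not> dim (U \<inter> S) \<le> h"
    then have "weight x y h 0 k (dim (U \<inter> S)) = 1" by (simp add: weight_eq_1)
    moreover have "weight x y h 0 k (dim (U \<inter> S)) \<le> (\<Sum>S\<in>\<A>. weight x y h 0 k (dim (U \<inter> S)))"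
      using that card_spread(1)[OF \<A>] x2 y by (intro member_le_sum weight_nonneg) auto
    ultimately show False using sum by simp
  qed
  with U show ?thesis by (auto simp: evasive_def)
qed

end

section \<open>From the real bounds to natural-number exponents\<close>

theorem proposition4p15:
  fixes scale :: "'k::{field,finite} \<Rightarrow> 'v::ab_group_add \<Rightarrow> 'v"
    and \<A> :: "'v set set"
    and q N m h :: nat
  assumes "vector_space scale"
    and "q = CARD('k)"
    and "vector_space.dim scale (UNIV :: 'v set) = N"
    and "N \<ge> 2"
    and "vector_space.is_spread scale m \<A>"
    and "1 \<le> h" and "h \<le> m - 1"
    and "real q \<ge> 64 powr (1 / (real h + 1))"
  shows "\<forall>k::nat. 0 < k \<and>
           real k \<le> real h * real N / (real h + 1) + real m / (real h + 1) - real m + real h \<longrightarrow>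
           (\<exists>U. vector_space.evasive scale \<A> h U \<and> vector_space.dim scale U = k)"
proof (intro allI impI, elim conjE)
  fix k :: nat
  assume k: "real k \<le> real h * real N / (real h + 1) + real m / (real h + 1) - real m + real h"
  interpret vector_space scale by fact
  obtain B where B: "independent B" "UNIV \<subseteq> span B" "card B = N"
    using basis_exists[of UNIV] assms(3) by metis
  \<comment> \<open>An infinite set has \<open>card\<close> 0, so \<open>N \<ge> 2\<close> forces
    finiteness.\<close>
  have "finite B" using B(3) assms(4) by (intro card_ge_0_finite) simp
  interpret finite_vector_space scale B
    by unfold_locales (use B \<open>finite B\<close> in auto)
  have N: "dim UNIV = N" by fact
  obtain v :: 'v where "v \<noteq> 0"
    using N assms(4) dim_eq_0[of UNIV] by (auto simp del: dim_eq_0 dim_UNIV)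
  then obtain S where "S \<in> \<A>" using assms(5) by (auto simp: is_spread_def)
  then have m: "m \<le> N" using assms(5) dim_subset[of S UNIV] N by (auto simp: is_spread_def)
  define H where "H = real h + 1"
  have H: "H > 0" by (simp add: H_def)
  have "real (Suc h * k) = real k * H" by (simp add: H_def algebra_simps)
  also have "\<dots> \<le> (real h * real N / H + real m / H - real m + real h) * H"
    using k H unfolding H_def by (intro mult_right_mono) auto
  also have "\<dots> = real h * real N + real m - real m * H + real h * H"
    using H by (simp add: distrib_right left_diff_distrib)
  also have "\<dots> = real (h * (N - m) + h * Suc h)"
    unfolding of_nat_add of_nat_mult of_nat_diff[OF m] H_def by (simp add: algebra_simps)
  finally have k': "Suc h * k \<le> h * (N - m) + h * Suc h"
    by (simp only: of_nat_le_iff)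
  \<comment> \<open>Enlarging \<open>h\<close> to \<open>Suc h\<close> allows cancellation; with
    \<open>h \<le> m - 1\<close> the result gives \<open>k \<le> N\<close>.\<close>
  also have "\<dots> \<le> Suc h * (N - m) + Suc h * h"
    by (intro add_mono mult_right_mono) auto
  also have "\<dots> = Suc h * (N - m + h)" by (simp add: algebra_simps)
  finally have "k \<le> N - m + h" by (simp only: Suc_mult_le_cancel1)
  then have kN: "k \<le> N" using m assms(6,7) by linarith
  have "64 = (64 powr (1 / (real h + 1))) ^ Suc h"
    by (simp add: powr_realpow[symmetric] powr_powr add.commute del: power_Suc)
  also have "\<dots> \<le> real CARD('k) ^ Suc h"
    using assms(2,8) by (intro power_mono) auto
  finally have "real CARD('k) ^ Suc h > 8" by linarith
  then show "\<exists>U. evasive \<A> h U \<and> dim U = k"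
    using assms(5-7) m kN k' by (intro exists_evasive) (auto simp: N simp del: dim_UNIV)
qed

end
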